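(* Let $\Phi=(A;\{E_i\}_{i=0}^d;A^*;\{E^*_i\}_{i=0}^d)$ be a Leonard system on $V$, with $d\ge 3$ and with $\mathbb F$ algebraically closed. Assume that $\Phi$ has one of the following types: dual $q$-Krawtchouk, Hahn, Krawtchouk. Then the zero diagonal space satisfies ${\mathcal Z}(\Phi)\neq 0$.
   Context: Let $\mathbb F$ be an algebraically closed field and $V$ a vector space over $\mathbb F$ of dimension $d+1$ with $d\ge 3$. "Scalar" means element of $\mathbb F$; integers appearing in formulas are read in $\mathbb F$. A tridiagonal matrix is irreducible if all entries on its subdiagonal and superdiagonal are nonzero. A Leonard pair on $V$ is an ordered pair $A,A^*\in \mathrm{End}(V)$ such that (i) there is a basis of $V$ with respect to which $A$ is irreducible tridiagonal and $A^*$ is diagonal; (ii) there is a basis of $V$ with respect to which $A^*$ is irreducible tridiagonal and $A$ is diagonal. Then $A,A^*$ are multiplicity-free (diagonalizable with one-dimensional eigenspaces). The primitive idempotent of $A$ for an eigenvalue $\theta$ is the projection onto the $\theta$-eigenspace along the sum of the other eigenspaces. An ordering $\{\theta_i\}_{i=0}^d$ of the eigenvalues of $A$ (and the corresponding ordering $\{E_i\}_{i=0}^d$ of primitive idempotents) is standard if corresponding eigenvectors $v_0,\dots,v_d$, in this order, form a basis as in (ii). Standard orderings for $A^*$ are defined similarly using (i). A Leonard system on $V$ is a sequence $\Phi=(A;\{E_i\}_{i=0}^d;A^*;\{E^*_i\}_{i=0}^d)$ where $A,A^*$ is a Leonard pair on $V$ and $\{E_i\}$, $\{E^*_i\}$ are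 standard orderings of the primitive idempotents of $A$, $A^*$. Parameter array: $\theta_i$ (resp. $\theta^*_i$) is the eigenvalue of $A$ (resp. $A^*$) for $E_i$ (resp. $E^*_i$). For $0\ne u\in E^*_0V$ the vectors $u_i=(A-\theta_0I)\cdots(A-\theta_{i-1}I)u$ $(0\le i\le d)$ form a basis of $V$, and $A^*u_0=\theta^*_0u_0$, $A^*u_i=\theta^*_iu_i+\varphi_iu_{i-1}$ $(1\le i\le d)$ for nonzero scalars $\varphi_i$; $\{\varphi_i\}_{i=1}^d$ is the first split sequence of $\Phi$. The second split sequence $\{\phi_i\}_{i=1}^d$ is the first split sequence of the Leonard system $(A;\{E_{d-i}\}_{i=0}^d;A^*;\{E^*_i\}_{i=0}^d)$. Zero diagonal space: ${\mathcal Z}(\Phi)$ is the set of $X\in\mathrm{Span}\{I,A^*,A,AA^*\}$ such that $E^*_iXE^*_i=0$ for $0\le i\le d$. Types: Dual $q$-Krawtchouk type: there exist nonzero scalars $q,h,h^*,s$ with $q^i\ne1$ $(1\le i\le d)$, $sq^i\neq 1$ $(2\le i\le 2d)$, such that $\theta_i=\theta_0+h(1-q^i)(1-sq^{i+1})q^{-i}$, $\theta^*_i=\theta^*_0+h^*(1-q^i)q^{-i}$ $(0\le i\le d)$; $\varphi_i=hh^*q^{1-2i}(1-q^i)(1-q^{i-d-1})$, $\phi_i=hh^*sq^{d+2-2i}(1-q^i)(1-q^{i-d-1})$ $(1\le i\le d)$. Hahn type: there exist scalars $h^*,s,s^*,r$ with $h^*,s$ nonzero; $\mathrm{char}\,\mathbb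 F$ is $0$ or a prime greater than $d$; neither of $r,\,s^*-r$ equals $-i$ for $1\le i\le d$; $s^*\ne -i$ for $2\le i\le 2d$; $\theta_i=\theta_0+si$, $\theta^*_i=\theta^*_0+h^*i(i+1+s^* )$ $(0\le i\le d)$; $\varphi_i=h^*si(i-d-1)(i+r)$, $\phi_i=-h^*si(i-d-1)(i+s^*-r)$ $(1\le i\le d)$. Krawtchouk type: there exist nonzero scalars $s,s^*,r$ with $\mathrm{char}\,\mathbb F$ equal to $0$ or a prime greater than $d$; $r\ne ss^*$; $\theta_i=\theta_0+si$, $\theta^*_i=\theta^*_0+s^*i$ $(0\le i\le d)$; $\varphi_i=ri(i-d-1)$, $\phi_i=(r-ss^* )i(i-d-1)$ $(1\le i\le d)$. *)

theory Defs
  imports "HOL-Computational_Algebra.Computational_Algebra"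
begin

text \<open>
  Sequences indexed by \<open>0, \<dots>, d\<close> (or \<open>1, \<dots>, d\<close>) are functions on \<^typ>\<open>nat\<close> of which only the
  values at these indices matter.  Starred objects carry the suffix \<open>s\<close>.
\<close>

definition irreducible_tridiagonal :: "nat \<Rightarrow> (nat \<Rightarrow> nat \<Rightarrow> 'a::zero) \<Rightarrow> bool" where
  "irreducible_tridiagonal d B \<longleftrightarrow>
     (\<forall>i\<le>d. \<forall>j\<le>d. i > j + 1 \<or> j > i + 1 \<longrightarrow> B i j = 0) \<and>
     (\<forall>i<d. B (i + 1) i \<noteq> 0 \<and> B i (i + 1) \<noteq> 0)"

definition diagonal_upto :: "nat \<Rightarrow> (nat \<Rightarrow> nat \<Rightarrow> 'a::zero) \<Rightarrow> bool" where
  "diagonal_upto d B \<longleftrightarrow> (\<forall>i\<le>d. \<forall>j\<le>d. i \<noteq> j \<longrightarrow> B i j = 0)"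

text \<open>Definitions made directly in \<^locale>\<open>vector_space\<close> would be shadowed by their copies for real
  vector spaces, so they live in a synonym of that locale.\<close>

locale leonard_context = vector_space scale
  for scale :: "'a::field \<Rightarrow> 'b::ab_group_add \<Rightarrow> 'b" (infixr \<open>*s\<close> 75)
begin

definition ordered_basis :: "nat \<Rightarrow> (nat \<Rightarrow> 'b) \<Rightarrow> bool" where
  "ordered_basis d v \<longleftrightarrow>
     inj_on v {..d} \<and> independent (v ` {..d}) \<and> span (v ` {..d}) = UNIV"

text \<open>Column convention: for an ordered basis \<open>v\<close>, \<open>A (v j)\<close> is the sum over \<open>i\<close> of
  \<open>matrix_wrt d v A i j *s v i\<close>.\<close>

definition matrix_wrt :: "nat \<Rightarrow> (nat \<Rightarrow> 'b) \<Rightarrow> ('b \<Rightarrow> 'b) \<Rightarrow> nat \<Rightarrow> nat \<Rightarrow> 'a" where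
  "matrix_wrt d v A i j = representation (v ` {..d}) (A (v j)) (v i)"

definition tridiagonal_diagonal_basis ::
    "nat \<Rightarrow> (nat \<Rightarrow> 'b) \<Rightarrow> ('b \<Rightarrow> 'b) \<Rightarrow> ('b \<Rightarrow> 'b) \<Rightarrow> bool" where
  "tridiagonal_diagonal_basis d v A As \<longleftrightarrow>
     ordered_basis d v \<and>
     irreducible_tridiagonal d (matrix_wrt d v A) \<and>
     diagonal_upto d (matrix_wrt d v As)"

definition leonard_pair :: "nat \<Rightarrow> ('b \<Rightarrow> 'b) \<Rightarrow> ('b \<Rightarrow> 'b) \<Rightarrow> bool" where
  "leonard_pair d A As \<longleftrightarrow>
     Vector_Spaces.linear scale scale A \<and> Vector_Spaces.linear scale scale As \<and>
     (\<exists>v. tridiagonal_diagonal_basis d v A As) \<and>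
     (\<exists>v. tridiagonal_diagonal_basis d v As A)"

definition eigenspace :: "('b \<Rightarrow> 'b) \<Rightarrow> 'a \<Rightarrow> 'b set" where
  "eigenspace A \<mu> = {x. A x = \<mu> *s x}"

definition eigenvalue :: "('b \<Rightarrow> 'b) \<Rightarrow> 'a \<Rightarrow> bool" where
  "eigenvalue A \<mu> \<longleftrightarrow> (\<exists>x. x \<noteq> 0 \<and> x \<in> eigenspace A \<mu>)"

definition projection_onto_along :: "'b set \<Rightarrow> 'b set \<Rightarrow> ('b \<Rightarrow> 'b) \<Rightarrow> bool" where
  "projection_onto_along U W P \<longleftrightarrow>
     Vector_Spaces.linear scale scale P \<and> (\<forall>x. P (P x) = P x) \<and>
     range P = U \<and> {x. P x = 0} = W"

definition primitive_idempotent :: "('b \<Rightarrow> 'b) \<Rightarrow> 'a \<Rightarrow> ('b \<Rightarrow> 'b) \<Rightarrow> bool" where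
  "primitive_idempotent A \<mu> P \<longleftrightarrow>
     eigenvalue A \<mu> \<and>
     projection_onto_along (eigenspace A \<mu>)
       (span (\<Union>\<nu>\<in>{\<nu>. eigenvalue A \<nu> \<and> \<nu> \<noteq> \<mu>}. eigenspace A \<nu>)) P"

text \<open>\<open>\<theta>\<close> is a standard ordering of the eigenvalues of \<open>A\<close>, for the Leonard pair \<open>A, As\<close>.  The standard
  orderings of the eigenvalues of \<open>As\<close> are those of the Leonard pair \<open>As, A\<close>.\<close>

definition standard_ordering ::
    "nat \<Rightarrow> ('b \<Rightarrow> 'b) \<Rightarrow> ('b \<Rightarrow> 'b) \<Rightarrow> (nat \<Rightarrow> 'a) \<Rightarrow> bool" where
  "standard_ordering d A As \<theta> \<longleftrightarrow>
     bij_betw \<theta> {..d} {\<mu>. eigenvalue A \<mu>} \<and>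
     (\<exists>v. (\<forall>i\<le>d. v i \<in> eigenspace A (\<theta> i)) \<and> tridiagonal_diagonal_basis d v As A)"

definition eigenvalue_sequence ::
    "nat \<Rightarrow> ('b \<Rightarrow> 'b) \<Rightarrow> (nat \<Rightarrow> 'b \<Rightarrow> 'b) \<Rightarrow> (nat \<Rightarrow> 'a) \<Rightarrow> bool" where
  "eigenvalue_sequence d A E \<theta> \<longleftrightarrow> (\<forall>i\<le>d. primitive_idempotent A (\<theta> i) (E i))"

definition leonard_system ::
    "nat \<Rightarrow> ('b \<Rightarrow> 'b) \<Rightarrow> (nat \<Rightarrow> 'b \<Rightarrow> 'b) \<Rightarrow> ('b \<Rightarrow> 'b) \<Rightarrow> (nat \<Rightarrow> 'b \<Rightarrow> 'b) \<Rightarrow> bool" where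
  "leonard_system d A E As Es \<longleftrightarrow>
     leonard_pair d A As \<and>
     (\<exists>\<theta>. standard_ordering d A As \<theta> \<and> eigenvalue_sequence d A E \<theta>) \<and>
     (\<exists>\<theta>s. standard_ordering d As A \<theta>s \<and> eigenvalue_sequence d As Es \<theta>s)"

text \<open>\<open>split_vector A \<theta> u i\<close> is \<open>(A - \<theta> 0) \<cdots> (A - \<theta> (i - 1)) u\<close>.\<close>

definition split_vector :: "('b \<Rightarrow> 'b) \<Rightarrow> (nat \<Rightarrow> 'a) \<Rightarrow> 'b \<Rightarrow> nat \<Rightarrow> 'b" where
  "split_vector A \<theta> u i = foldr (\<lambda>k x. A x - \<theta> k *s x) [0..<i] u"

text \<open>For a Leonard system, \<open>\<theta>\<close> and \<open>\<theta>s\<close> are determined on \<open>{..d}\<close>, and the equations below determine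
  \<open>\<phi>\<close> on \<open>{1..d}\<close>.  That the split vectors form a basis and that \<open>\<phi> i \<noteq> 0\<close> is then a theorem, hence not
  part of the definition.\<close>

definition first_split_sequence ::
    "nat \<Rightarrow> ('b \<Rightarrow> 'b) \<Rightarrow> (nat \<Rightarrow> 'b \<Rightarrow> 'b) \<Rightarrow> ('b \<Rightarrow> 'b) \<Rightarrow> (nat \<Rightarrow> 'b \<Rightarrow> 'b) \<Rightarrow> (nat \<Rightarrow> 'a) \<Rightarrow> bool" where
  "first_split_sequence d A E As Es \<phi> \<longleftrightarrow>
     (\<exists>\<theta> \<theta>s. eigenvalue_sequence d A E \<theta> \<and> eigenvalue_sequence d As Es \<theta>s \<and>
        (\<forall>u\<in>range (Es 0). u \<noteq> 0 \<longrightarrow>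
           As (split_vector A \<theta> u 0) = \<theta>s 0 *s split_vector A \<theta> u 0 \<and>
           (\<forall>i\<in>{1..d}. As (split_vector A \<theta> u i) =
              \<theta>s i *s split_vector A \<theta> u i + \<phi> i *s split_vector A \<theta> u (i - 1))))"

definition second_split_sequence ::
    "nat \<Rightarrow> ('b \<Rightarrow> 'b) \<Rightarrow> (nat \<Rightarrow> 'b \<Rightarrow> 'b) \<Rightarrow> ('b \<Rightarrow> 'b) \<Rightarrow> (nat \<Rightarrow> 'b \<Rightarrow> 'b) \<Rightarrow> (nat \<Rightarrow> 'a) \<Rightarrow> bool" where
  "second_split_sequence d A E As Es \<phi> \<longleftrightarrow>
     first_split_sequence d A (\<lambda>i. E (d - i)) As Es \<phi>"

definition parameter_array ::
    "nat \<Rightarrow> ('b \<Rightarrow> 'b) \<Rightarrow> (nat \<Rightarrow> 'b \<Rightarrow> 'b) \<Rightarrow> ('b \<Rightarrow> 'b) \<Rightarrow> (nat \<Rightarrow> 'b \<Rightarrow> 'b) \<Rightarrow>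
     (nat \<Rightarrow> 'a) \<Rightarrow> (nat \<Rightarrow> 'a) \<Rightarrow> (nat \<Rightarrow> 'a) \<Rightarrow> (nat \<Rightarrow> 'a) \<Rightarrow> bool" where
  "parameter_array d A E As Es \<theta> \<theta>s \<phi>1 \<phi>2 \<longleftrightarrow>
     eigenvalue_sequence d A E \<theta> \<and> eigenvalue_sequence d As Es \<theta>s \<and>
     first_split_sequence d A E As Es \<phi>1 \<and> second_split_sequence d A E As Es \<phi>2"

definition zero_diagonal_space ::
    "nat \<Rightarrow> ('b \<Rightarrow> 'b) \<Rightarrow> ('b \<Rightarrow> 'b) \<Rightarrow> (nat \<Rightarrow> 'b \<Rightarrow> 'b) \<Rightarrow> ('b \<Rightarrow> 'b) set" where
  "zero_diagonal_space d A As Es =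
     {X. (\<exists>a b c e. X = (\<lambda>x. a *s x + b *s As x + c *s A x + e *s A (As x))) \<and>
         (\<forall>i\<le>d. Es i \<circ> X \<circ> Es i = (\<lambda>x. 0))}"

end

definition dual_q_Krawtchouk_array ::
    "nat \<Rightarrow> (nat \<Rightarrow> 'a::field) \<Rightarrow> (nat \<Rightarrow> 'a) \<Rightarrow> (nat \<Rightarrow> 'a) \<Rightarrow> (nat \<Rightarrow> 'a) \<Rightarrow> bool" where
  "dual_q_Krawtchouk_array d \<theta> \<theta>s \<phi>1 \<phi>2 \<longleftrightarrow>
     (\<exists>q h hs s. q \<noteq> 0 \<and> h \<noteq> 0 \<and> hs \<noteq> 0 \<and> s \<noteq> 0 \<and>
        (\<forall>i\<in>{1..d}. q ^ i \<noteq> 1) \<and>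
        (\<forall>i\<in>{2..2 * d}. s * q ^ i \<noteq> 1) \<and>
        (\<forall>i\<in>{0..d}. \<theta> i = \<theta> 0 + h * (1 - q ^ i) * (1 - s * q ^ (i + 1)) * q powi (- int i)) \<and>
        (\<forall>i\<in>{0..d}. \<theta>s i = \<theta>s 0 + hs * (1 - q ^ i) * q powi (- int i)) \<and>
        (\<forall>i\<in>{1..d}. \<phi>1 i = h * hs * q powi (1 - 2 * int i) * (1 - q ^ i)
                              * (1 - q powi (int i - int d - 1))) \<and>
        (\<forall>i\<in>{1..d}. \<phi>2 i = h * hs * s * q powi (int d + 2 - 2 * int i) * (1 - q ^ i)
                              * (1 - q powi (int i - int d - 1))))"

definition Hahn_array ::
    "nat \<Rightarrow> (nat \<Rightarrow> 'a::field) \<Rightarrow> (nat \<Rightarrow> 'a) \<Rightarrow> (nat \<Rightarrow> 'a) \<Rightarrow> (nat \<Rightarrow> 'a) \<Rightarrow> bool" where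
  "Hahn_array d \<theta> \<theta>s \<phi>1 \<phi>2 \<longleftrightarrow>
     (\<exists>hs s ss r. hs \<noteq> 0 \<and> s \<noteq> 0 \<and>
        (CHAR('a) = 0 \<or> prime CHAR('a) \<and> CHAR('a) > d) \<and>
        (\<forall>i\<in>{1..d}. r \<noteq> - of_nat i \<and> ss - r \<noteq> - of_nat i) \<and>
        (\<forall>i\<in>{2..2 * d}. ss \<noteq> - of_nat i) \<and>
        (\<forall>i\<in>{0..d}. \<theta> i = \<theta> 0 + s * of_nat i) \<and>
        (\<forall>i\<in>{0..d}. \<theta>s i = \<theta>s 0 + hs * of_nat i * (of_nat i + 1 + ss)) \<and>
        (\<forall>i\<in>{1..d}. \<phi>1 i = hs * s * of_nat i * (of_nat i - of_nat d - 1) * (of_nat i + r)) \<and>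
        (\<forall>i\<in>{1..d}. \<phi>2 i = - hs * s * of_nat i * (of_nat i - of_nat d - 1) * (of_nat i + ss - r)))"

definition Krawtchouk_array ::
    "nat \<Rightarrow> (nat \<Rightarrow> 'a::field) \<Rightarrow> (nat \<Rightarrow> 'a) \<Rightarrow> (nat \<Rightarrow> 'a) \<Rightarrow> (nat \<Rightarrow> 'a) \<Rightarrow> bool" where
  "Krawtchouk_array d \<theta> \<theta>s \<phi>1 \<phi>2 \<longleftrightarrow>
     (\<exists>s ss r. s \<noteq> 0 \<and> ss \<noteq> 0 \<and> r \<noteq> 0 \<and>
        (CHAR('a) = 0 \<or> prime CHAR('a) \<and> CHAR('a) > d) \<and>
        r \<noteq> s * ss \<and>
        (\<forall>i\<in>{0..d}. \<theta> i = \<theta> 0 + s * of_nat i) \<and>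
        (\<forall>i\<in>{0..d}. \<theta>s i = \<theta>s 0 + ss * of_nat i) \<and>
        (\<forall>i\<in>{1..d}. \<phi>1 i = r * of_nat i * (of_nat i - of_nat d - 1)) \<and>
        (\<forall>i\<in>{1..d}. \<phi>2 i = (r - s * ss) * of_nat i * (of_nat i - of_nat d - 1)))"

context leonard_context
begin

definition dual_q_Krawtchouk_type ::
    "nat \<Rightarrow> ('b \<Rightarrow> 'b) \<Rightarrow> (nat \<Rightarrow> 'b \<Rightarrow> 'b) \<Rightarrow> ('b \<Rightarrow> 'b) \<Rightarrow> (nat \<Rightarrow> 'b \<Rightarrow> 'b) \<Rightarrow> bool" where
  "dual_q_Krawtchouk_type d A E As Es \<longleftrightarrow>
     (\<exists>\<theta> \<theta>s \<phi>1 \<phi>2. parameter_array d A E As Es \<theta> \<theta>s \<phi>1 \<phi>2 \<and> dual_q_Krawtchouk_array d \<theta> \<theta>s \<phi>1 \<phi>2)"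

definition Hahn_type ::
    "nat \<Rightarrow> ('b \<Rightarrow> 'b) \<Rightarrow> (nat \<Rightarrow> 'b \<Rightarrow> 'b) \<Rightarrow> ('b \<Rightarrow> 'b) \<Rightarrow> (nat \<Rightarrow> 'b \<Rightarrow> 'b) \<Rightarrow> bool" where
  "Hahn_type d A E As Es \<longleftrightarrow>
     (\<exists>\<theta> \<theta>s \<phi>1 \<phi>2. parameter_array d A E As Es \<theta> \<theta>s \<phi>1 \<phi>2 \<and> Hahn_array d \<theta> \<theta>s \<phi>1 \<phi>2)"

definition Krawtchouk_type ::
    "nat \<Rightarrow> ('b \<Rightarrow> 'b) \<Rightarrow> (nat \<Rightarrow> 'b \<Rightarrow> 'b) \<Rightarrow> ('b \<Rightarrow> 'b) \<Rightarrow> (nat \<Rightarrow> 'b \<Rightarrow> 'b) \<Rightarrow> bool" where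
  "Krawtchouk_type d A E As Es \<longleftrightarrow>
     (\<exists>\<theta> \<theta>s \<phi>1 \<phi>2. parameter_array d A E As Es \<theta> \<theta>s \<phi>1 \<phi>2 \<and> Krawtchouk_array d \<theta> \<theta>s \<phi>1 \<phi>2)"

end

end

theory Submission
  imports Defs
begin

text \<open>
  In an eigenbasis of \<open>As\<close>, with \<open>a\<^sub>i\<close> the diagonal entries of \<open>A\<close>, an element
  \<open>a I + b As + c A + e A As\<close> has zero diagonal iff \<open>a + b \<theta>s\<^sub>i + (c + e \<theta>s\<^sub>i) a\<^sub>i = 0\<close> for
  all \<open>i\<close>, and it is nonzero when \<open>(c, e) \<noteq> (0, 0)\<close>, because \<open>A\<close> has nonzero off-diagonal
  entries. Comparing the two leading coordinates of consecutive split vectors gives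
  \<open>a\<^sub>i = \<theta>\<^sub>i + \<epsilon>\<^sub>i\<^sub>+\<^sub>1 - \<epsilon>\<^sub>i\<close> with \<open>\<epsilon>\<^sub>i (\<theta>s\<^sub>i - \<theta>s\<^sub>i\<^sub>-\<^sub>1) = - \<phi>\<^sub>i\<close> and
  \<open>\<epsilon>\<^sub>0 = \<epsilon>\<^sub>d\<^sub>+\<^sub>1 = 0\<close>. In the Krawtchouk and Hahn types \<open>a\<^sub>i\<close> is, respectively, an affine and a
  fractional linear function of \<open>\<theta>s\<^sub>i\<close>; in the dual \<open>q\<close>-Krawtchouk type \<open>a\<^sub>i\<close> is affine in
  \<open>q\<^sup>i\<close> while \<open>\<theta>s\<^sub>i\<close> is affine in \<open>q\<^sup>-\<^sup>i\<close>.
\<close>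

section \<open>Coordinates with respect to an ordered basis\<close>

context leonard_context
begin

definition coord :: "nat \<Rightarrow> (nat \<Rightarrow> 'b) \<Rightarrow> 'b \<Rightarrow> nat \<Rightarrow> 'a" where
  "coord d v x k = representation (v ` {..d}) x (v k)"

lemma sum_coord:
  assumes "ordered_basis d v"
  shows "(\<Sum>k\<le>d. coord d v x k *s v k) = x"
proof -
  from assms have inj: "inj_on v {..d}" and ind: "independent (v ` {..d})"
    and sp: "span (v ` {..d}) = UNIV"
    by (auto simp: ordered_basis_def)
  have "(\<Sum>k\<le>d. coord d v x k *s v k)
      = (\<Sum>b\<in>v ` {..d}. representation (v ` {..d}) x b *s b)"
    using inj by (simp add: coord_def sum.reindex)
  also have "\<dots> = x"
    using sum_representation_eq[OF ind, of x "v ` {..d}"] sp by auto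
  finally show ?thesis .
qed

lemma coord_basis:
  assumes "ordered_basis d v" "j \<le> d" "k \<le> d"
  shows "coord d v (v j) k = (if j = k then 1 else 0)"
proof -
  from assms have "inj_on v {..d}" and ind: "independent (v ` {..d})"
    by (auto simp: ordered_basis_def)
  then have "v j = v k \<longleftrightarrow> j = k"
    using assms by (auto simp: inj_on_def)
  then show ?thesis
    using representation_basis[OF ind, of "v j"] assms by (auto simp: coord_def)
qed

lemma coord_zero [simp]: "coord d v 0 k = 0"
  by (simp add: coord_def representation_zero)

lemma coord_add:
  assumes "ordered_basis d v"
  shows "coord d v (x + y) k = coord d v x k + coord d v y k"
  using assms by (simp add: coord_def ordered_basis_def representation_add)

lemma coord_diff:
  assumes "ordered_basis d v"
  shows "coord d v (x - y) k = coord d v x k - coord d v y k"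
  using assms by (simp add: coord_def ordered_basis_def representation_diff)

lemma coord_scale:
  assumes "ordered_basis d v"
  shows "coord d v (c *s x) k = c * coord d v x k"
  using assms by (simp add: coord_def ordered_basis_def representation_scale)

lemma coord_sum:
  assumes "ordered_basis d v"
  shows "coord d v (\<Sum>j\<in>S. f j) k = (\<Sum>j\<in>S. coord d v (f j) k)"
  using assms by (simp add: coord_def ordered_basis_def representation_sum)

lemma linear_sum_coord:
  assumes "ordered_basis d v" "Vector_Spaces.linear scale scale f"
  shows "f x = (\<Sum>j\<le>d. coord d v x j *s f (v j))"
proof -
  interpret f: Vector_Spaces.linear scale scale f by fact
  have "f x = f (\<Sum>j\<le>d. coord d v x j *s v j)"
    by (simp add: sum_coord[OF assms(1)])
  then show ?thesis
    by (simp add: f.sum f.scale)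
qed

lemma matrix_wrt_eq_coord: "matrix_wrt d v f i j = coord d v (f (v j)) i"
  by (simp add: coord_def matrix_wrt_def)

lemma coord_linear:
  assumes "ordered_basis d v" "Vector_Spaces.linear scale scale f"
  shows "coord d v (f x) i = (\<Sum>j\<le>d. coord d v x j * matrix_wrt d v f i j)"
  by (subst linear_sum_coord[OF assms])
    (simp add: coord_sum[OF assms(1)] coord_scale[OF assms(1)] matrix_wrt_eq_coord)

section \<open>Split vectors and eigenvalue sequences\<close>

lemma split_vector_0 [simp]: "split_vector A \<theta> u 0 = u"
  by (simp add: split_vector_def)

text \<open>\<open>foldr\<close> applies the factor of largest index first, so passing from
  \<open>i\<close> to \<open>Suc i\<close> inserts the new factor next to \<open>u\<close>. The
  auxiliary induction moves it to the outside, because the factors commute.\<close>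

lemma split_vector_Suc:
  assumes "Vector_Spaces.linear scale scale A"
  shows "split_vector A \<theta> u (Suc i) = A (split_vector A \<theta> u i) - \<theta> i *s split_vector A \<theta> u i"
proof -
  interpret A: Vector_Spaces.linear scale scale A by fact
  have "foldr (\<lambda>k x. A x - \<theta> k *s x) ks (A u - \<mu> *s u)
      = A (foldr (\<lambda>k x. A x - \<theta> k *s x) ks u) - \<mu> *s foldr (\<lambda>k x. A x - \<theta> k *s x) ks u"
    for ks \<mu>
  proof (induction ks)
    case (Cons k ks)
    show ?case
      by (simp only: foldr.simps o_apply Cons.IH) (simp add: A.diff A.scale algebra_simps)
  qed simp
  then show ?thesis
    by (simp add: split_vector_def)
qed

lemma split_vector_cong:
  assumes "\<And>k. k < i \<Longrightarrow> \<theta> k = \<theta>' k"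
  shows "split_vector A \<theta> u i = split_vector A \<theta>' u i"
  unfolding split_vector_def using assms by (intro foldr_cong) auto

lemma split_vector_linear:
  assumes "Vector_Spaces.linear scale scale A"
  shows "Vector_Spaces.linear scale scale (\<lambda>u. split_vector A \<theta> u i)"
proof (induction i)
  case 0
  then show ?case by (simp add: linear_id[unfolded id_def])
next
  case (Suc i)
  interpret A: Vector_Spaces.linear scale scale A by fact
  interpret S: Vector_Spaces.linear scale scale "\<lambda>u. split_vector A \<theta> u i" by fact
  show ?case
    by unfold_locales
      (simp_all add: split_vector_Suc[OF assms] A.add A.scale S.add S.scale algebra_simps)
qed

lemma split_vector_eigenvector:
  assumes "Vector_Spaces.linear scale scale A" "x \<in> eigenspace A \<mu>"
  shows "split_vector A \<theta> x i = (\<Prod>k<i. \<mu> - \<theta> k) *s x"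
proof -
  interpret A: Vector_Spaces.linear scale scale A by fact
  show ?thesis
    using assms(2)
    by (induction i)
      (simp_all add: split_vector_Suc[OF assms(1)] A.scale eigenspace_def algebra_simps)
qed

text \<open>The range of a primitive idempotent is its eigenspace, and any nonzero vector of it
  determines the eigenvalue. This reconciles the eigenvalue sequences that several definitions
  introduce existentially.\<close>

lemma eigenvalue_sequence_unique:
  assumes "eigenvalue_sequence d A E \<theta>" "eigenvalue_sequence d A E \<theta>'" "i \<le> d"
  shows "\<theta> i = \<theta>' i"
proof -
  have p: "primitive_idempotent A (\<theta> i) (E i)" "primitive_idempotent A (\<theta>' i) (E i)"
    using assms by (auto simp: eigenvalue_sequence_def)
  then have eq: "eigenspace A (\<theta> i) = eigenspace A (\<theta>' i)"
    by (auto simp: primitive_idempotent_def projection_onto_along_def)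
  obtain x where "x \<noteq> 0" "x \<in> eigenspace A (\<theta> i)"
    using p(1) by (auto simp: primitive_idempotent_def eigenvalue_def)
  moreover from this eq have "x \<in> eigenspace A (\<theta>' i)"
    by simp
  ultimately have "\<theta> i *s x = \<theta>' i *s x"
    by (simp add: eigenspace_def)
  with \<open>x \<noteq> 0\<close> show ?thesis
    by simp
qed

end

section \<open>The matrix of \<open>A\<close> in an eigenbasis \<open>v\<close> of
  \<open>As\<close>\<close>

locale leonard_eigenbases = leonard_context scale
  for scale :: "'a::field \<Rightarrow> 'b::ab_group_add \<Rightarrow> 'b" (infixr \<open>*s\<close> 75) +
  fixes d :: nat and A As :: "'b \<Rightarrow> 'b" and Es :: "nat \<Rightarrow> 'b \<Rightarrow> 'b"
    and \<theta> \<theta>s \<phi> :: "nat \<Rightarrow> 'a" and v w :: "nat \<Rightarrow> 'b"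
  assumes linear_A: "Vector_Spaces.linear scale scale A"
    and linear_As: "Vector_Spaces.linear scale scale As"
    and basis_v: "ordered_basis d v"
    and tridiagonal: "irreducible_tridiagonal d (matrix_wrt d v A)"
    and eigenvector_v: "i \<le> d \<Longrightarrow> As (v i) = \<theta>s i *s v i"
    and inj_\<theta>s: "inj_on \<theta>s {..d}"
    and basis_w: "ordered_basis d w"
    and eigenvector_w: "i \<le> d \<Longrightarrow> w i \<in> eigenspace A (\<theta> i)"
    and idempotents: "eigenvalue_sequence d As Es \<theta>s"
    and split: "i \<in> {1..d} \<Longrightarrow> As (split_vector A \<theta> (v 0) i) =
      \<theta>s i *s split_vector A \<theta> (v 0) i + \<phi> i *s split_vector A \<theta> (v 0) (i - 1)"
begin

abbreviation B :: "nat \<Rightarrow> nat \<Rightarrow> 'a" where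
  "B \<equiv> matrix_wrt d v A"

abbreviation u :: "nat \<Rightarrow> 'b" where
  "u \<equiv> split_vector A \<theta> (v 0)"

abbreviation co :: "'b \<Rightarrow> nat \<Rightarrow> 'a" where
  "co \<equiv> coord d v"

lemmas co_simps = coord_add[OF basis_v] coord_diff[OF basis_v] coord_scale[OF basis_v]

lemma B_eq_0: "i \<le> d \<Longrightarrow> j \<le> d \<Longrightarrow> i > j + 1 \<or> j > i + 1 \<Longrightarrow> B i j = 0"
  using tridiagonal by (auto simp: irreducible_tridiagonal_def)

lemma B_subdiagonal: "i < d \<Longrightarrow> B (Suc i) i \<noteq> 0"
  using tridiagonal by (auto simp: irreducible_tridiagonal_def)

lemma v_nonzero: "i \<le> d \<Longrightarrow> v i \<noteq> 0"
  using coord_basis[OF basis_v, of i i] by auto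

lemma co_As:
  assumes "i \<le> d"
  shows "co (As x) i = \<theta>s i * co x i"
proof -
  have "co (As x) i = (\<Sum>j\<le>d. co x j * (if j = i then \<theta>s j else 0))"
    using assms
    by (subst linear_sum_coord[OF basis_v linear_As])
      (auto simp: coord_sum[OF basis_v] co_simps eigenvector_v coord_basis[OF basis_v]
        intro!: sum.cong)
  then show ?thesis
    using assms by (simp add: if_distrib[of "(*) _"] cong: if_cong)
qed

text \<open>Since \<open>A\<close> is tridiagonal, each factor raises the highest occurring basis
  index by at most one, so \<open>u i\<close> stays in the span of \<open>v 0\<close>, ...,
  \<open>v i\<close>.\<close>

lemma co_u_above: "i < k \<Longrightarrow> k \<le> d \<Longrightarrow> co (u i) k = 0"
proof (induction i arbitrary: k)
  case 0
  then show ?case by (simp add: coord_basis[OF basis_v])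
next
  case (Suc i)
  have "co (u i) j * B k j = 0" if "j \<le> d" for j
    using Suc that B_eq_0[of k j] by (cases "j \<le> i") auto
  then have "(\<Sum>j\<le>d. co (u i) j * B k j) = 0"
    by (intro sum.neutral) auto
  then show ?case
    using Suc by (simp add: split_vector_Suc[OF linear_A] co_simps coord_linear[OF basis_v linear_A])
qed

lemma co_u_Suc_top:
  assumes "i < d"
  shows "co (u (Suc i)) (Suc i) = B (Suc i) i * co (u i) i"
proof -
  have "co (u i) j * B (Suc i) j = (if j = i then B (Suc i) i * co (u i) i else 0)"
    if "j \<le> d" for j
    using that assms B_eq_0[of "Suc i" j] co_u_above[of i j] by (cases j i rule: linorder_cases) auto
  then have "(\<Sum>j\<le>d. co (u i) j * B (Suc i) j) = B (Suc i) i * co (u i) i"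
    using assms by simp
  then show ?thesis
    using assms
    by (simp add: split_vector_Suc[OF linear_A] co_simps coord_linear[OF basis_v linear_A] co_u_above)
qed

lemma co_u_top_nonzero: "i \<le> d \<Longrightarrow> co (u i) i \<noteq> 0"
  by (induction i) (simp_all add: coord_basis[OF basis_v] co_u_Suc_top B_subdiagonal)

lemma co_u_Suc:
  assumes "i \<le> d"
  shows "co (u (Suc i)) i
    = (B i i - \<theta> i) * co (u i) i + (if i = 0 then 0 else B i (i - 1) * co (u i) (i - 1))"
proof -
  \<comment> \<open>For \<open>i = 0\<close> truncated subtraction makes \<open>i - 1\<close> equal
    to \<open>i\<close>; the inner conditional then removes the second term.\<close>
  have "co (u i) j * B i j = (if j = i then B i i * co (u i) i else 0)
     + (if j = i - 1 then (if i = 0 then 0 else B i (i - 1) * co (u i) (i - 1)) else 0)"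
    if "j \<le> d" for j
    using that assms B_eq_0[of i j] co_u_above[of i j] by (cases j i rule: linorder_cases) auto
  then have "(\<Sum>j\<le>d. co (u i) j * B i j)
      = B i i * co (u i) i + (if i = 0 then 0 else B i (i - 1) * co (u i) (i - 1))"
    using assms by (simp add: sum.distrib)
  then show ?thesis
    using assms
    by (simp add: split_vector_Suc[OF linear_A] co_simps coord_linear[OF basis_v linear_A]
        algebra_simps)
qed

text \<open>Each eigenvector \<open>w j\<close> is killed by the factor belonging to
  \<open>\<theta> j\<close>, and these vectors form a basis.\<close>

lemma u_end: "u (Suc d) = 0"
proof -
  have "split_vector A \<theta> (w j) (Suc d) = 0" if "j \<le> d" for j
  proof -
    have "(\<Prod>k<Suc d. \<theta> j - \<theta> k) = 0"
      using that by (intro prod_zero bexI[of _ j]) auto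
    then show ?thesis
      using split_vector_eigenvector[OF linear_A eigenvector_w[OF that]] by simp
  qed
  then show ?thesis
    by (subst linear_sum_coord[OF basis_w split_vector_linear[OF linear_A]]) simp
qed

text \<open>The second coordinate from the top of \<open>u i\<close>, normalized by the top
  coordinate of \<open>u (i - 1)\<close>. The value 0 at \<open>i = 0\<close>, like the one at
  \<open>Suc d\<close>, lets one formula cover the corner entries of the diagonal.\<close>

definition \<epsilon> :: "nat \<Rightarrow> 'a" where
  "\<epsilon> i = (if i = 0 then 0 else co (u i) (i - 1) / co (u (i - 1)) (i - 1))"

lemma \<epsilon>_0: "\<epsilon> 0 = 0"
  by (simp add: \<epsilon>_def)

lemma \<epsilon>_end: "\<epsilon> (Suc d) = 0"
  by (simp add: \<epsilon>_def u_end)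

text \<open>This is coordinate \<open>i - 1\<close> of the split relation for \<open>u i\<close>:
  there \<open>As\<close> acts as multiplication by \<open>\<theta>s (i - 1)\<close>.\<close>

lemma \<epsilon>_split:
  assumes "i \<in> {1..d}"
  shows "\<epsilon> i * (\<theta>s i - \<theta>s (i - 1)) = - \<phi> i"
proof -
  have nz: "co (u (i - 1)) (i - 1) \<noteq> 0"
    using assms by (intro co_u_top_nonzero) auto
  have "\<theta>s (i - 1) * co (u i) (i - 1) = co (As (u i)) (i - 1)"
    using assms co_As[of "i - 1" "u i"] by auto
  also have "\<dots> = \<theta>s i * co (u i) (i - 1) + \<phi> i * co (u (i - 1)) (i - 1)"
    using split[OF assms] by (simp add: co_simps)
  finally have "co (u i) (i - 1) * (\<theta>s i - \<theta>s (i - 1)) = - \<phi> i * co (u (i - 1)) (i - 1)"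
    by (simp add: algebra_simps)
  then show ?thesis
    using assms nz by (simp add: \<epsilon>_def field_simps)
qed

text \<open>For \<open>i > 0\<close>, divide \<open>co_u_Suc\<close> by the top coordinate of
  \<open>u i\<close>, which is \<open>B i (i - 1)\<close> times that of \<open>u (i - 1)\<close>:
  the off-diagonal term becomes \<open>\<epsilon> i\<close>.\<close>

lemma diagonal_entry:
  assumes "i \<le> d"
  shows "B i i = \<theta> i + \<epsilon> (Suc i) - \<epsilon> i"
proof (cases i)
  case 0
  then show ?thesis
    using assms co_u_Suc[of 0] co_u_top_nonzero[of 0] by (simp add: \<epsilon>_def)
next
  case (Suc j)
  have "co (u i) i = B i j * co (u j) j"
    using Suc assms by (simp add: co_u_Suc_top)
  moreover have "co (u i) i \<noteq> 0" "co (u j) j \<noteq> 0"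
    using Suc assms co_u_top_nonzero by auto
  moreover have "co (u (Suc i)) i = (B i i - \<theta> i) * co (u i) i + B i j * co (u i) j"
    using co_u_Suc[OF assms] Suc by simp
  ultimately show ?thesis
    using Suc by (simp add: \<epsilon>_def field_simps)
qed

section \<open>Elements of the zero diagonal space\<close>

lemma Es_eq:
  assumes "i \<le> d"
  shows "Es i x = co x i *s v i"
proof -
  have p: "primitive_idempotent As (\<theta>s i) (Es i)"
    using idempotents assms by (simp add: eigenvalue_sequence_def)
  then have lin: "Vector_Spaces.linear scale scale (Es i)" and idem: "\<And>y. Es i (Es i y) = Es i y"
    and range: "range (Es i) = eigenspace As (\<theta>s i)"
    and kernel: "{y. Es i y = 0}
      = span (\<Union>\<nu>\<in>{\<nu>. eigenvalue As \<nu> \<and> \<nu> \<noteq> \<theta>s i}. eigenspace As \<nu>)"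
    by (auto simp: primitive_idempotent_def projection_onto_along_def)
  \<comment> \<open>The vector \<open>v i\<close> lies in the range of the projection; every other
    \<open>v j\<close> belongs to a different eigenvalue and so lies in the kernel.\<close>
  have "Es i (v j) = (if j = i then v i else 0)" if "j \<le> d" for j
  proof (cases "j = i")
    case True
    have "v i \<in> range (Es i)"
      using assms by (simp add: range eigenspace_def eigenvector_v)
    then show ?thesis
      using idem True by auto
  next
    case False
    have "v j \<in> eigenspace As (\<theta>s j)"
      using that by (simp add: eigenspace_def eigenvector_v)
    moreover from this have "eigenvalue As (\<theta>s j)"
      using v_nonzero[OF that] by (auto simp: eigenvalue_def)
    moreover have "\<theta>s j \<noteq> \<theta>s i"
      using inj_\<theta>s that assms False by (auto simp: inj_on_def)
    ultimately have "v j \<in> {y. Es i y = 0}"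
      unfolding kernel by (intro span_base) auto
    then show ?thesis
      using False by simp
  qed
  then have "Es i x = (\<Sum>j\<le>d. if j = i then co x i *s v i else 0)"
    by (subst linear_sum_coord[OF basis_v lin]) (intro sum.cong, auto)
  then show ?thesis
    using assms by simp
qed

text \<open>The shifts \<open>t\<close> and \<open>p\<close> let each type choose convenient origins
  for \<open>\<theta>s i\<close> and for the diagonal entries. The element obtained is nonzero
  because a nonzero affine function cannot vanish at both \<open>\<theta>s 0\<close> and
  \<open>\<theta>s 1\<close>.\<close>

lemma zero_diagonal_space_nontrivial:
  assumes "d \<ge> 1" and "\<gamma> \<noteq> 0 \<or> \<delta> \<noteq> 0"
    and rel: "\<And>i. i \<le> d \<Longrightarrow>
      (\<gamma> + \<delta> * (\<theta>s i - t)) * (\<theta> i + \<epsilon> (Suc i) - \<epsilon> i - p) = \<alpha> + \<beta> * (\<theta>s i - t)"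
  shows "zero_diagonal_space d A As Es \<noteq> {\<lambda>x. 0}"
proof -
  interpret A: Vector_Spaces.linear scale scale A by (fact linear_A)
  interpret As: Vector_Spaces.linear scale scale As by (fact linear_As)
  \<comment> \<open>Expanding \<open>rel\<close> with these coefficients gives \<open>a + b *
    \<theta>s i + (c + \<delta> * \<theta>s i) * B i i = 0\<close>.\<close>
  define c where "c = \<gamma> - \<delta> * t"
  define a where "a = - c * p - \<alpha> + \<beta> * t"
  define b where "b = - \<delta> * p - \<beta>"
  define X where "X = (\<lambda>x. a *s x + b *s As x + c *s A x + \<delta> *s A (As x))"
  have co_X: "co (X (k *s v i)) j
      = k * ((a + b * \<theta>s i) * (if i = j then 1 else 0) + (c + \<delta> * \<theta>s i) * B j i)"
    if "i \<le> d" "j \<le> d" for i j k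
    using that
    by (simp add: X_def co_simps As.scale A.scale eigenvector_v coord_basis[OF basis_v]
        matrix_wrt_eq_coord algebra_simps)
  have diag: "a + b * \<theta>s i + (c + \<delta> * \<theta>s i) * B i i = 0" if "i \<le> d" for i
  proof -
    have "(\<gamma> + \<delta> * (\<theta>s i - t)) * (B i i - p) = \<alpha> + \<beta> * (\<theta>s i - t)"
      using rel[OF that] by (simp add: diagonal_entry[OF that])
    then show ?thesis
      by (simp add: a_def b_def c_def algebra_simps)
  qed
  have "Es i \<circ> X \<circ> Es i = (\<lambda>x. 0)" if "i \<le> d" for i
    using that diag[OF that] co_X[of i i] by (auto simp: Es_eq)
  then have mem: "X \<in> zero_diagonal_space d A As Es"
    unfolding zero_diagonal_space_def X_def by blast
  have "\<theta>s 0 \<noteq> \<theta>s 1"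
    using inj_\<theta>s assms(1) by (auto simp: inj_on_def)
  moreover have "\<delta> = 0 \<and> c = 0" if "c + \<delta> * \<theta>s 0 = 0" "c + \<delta> * \<theta>s 1 = 0"
  proof -
    have "\<delta> * (\<theta>s 0 - \<theta>s 1) = (c + \<delta> * \<theta>s 0) - (c + \<delta> * \<theta>s 1)"
      by (simp add: algebra_simps)
    also have "\<dots> = 0"
      by (simp only: that diff_self)
    finally have "\<delta> = 0"
      using \<open>\<theta>s 0 \<noteq> \<theta>s 1\<close> by simp
    with that show ?thesis
      by simp
  qed
  ultimately obtain i :: nat where i: "i \<in> {0, 1}" "c + \<delta> * \<theta>s i \<noteq> 0"
    using assms(2) by (fastforce simp: c_def)
  \<comment> \<open>\<open>1 - i\<close> is the other index among 0 and 1, so this is an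
    off-diagonal entry of \<open>X\<close>. The factor 1 matches the form of
    \<open>co_X\<close>.\<close>
  have "co (X (1 *s v i)) (1 - i) = (c + \<delta> * \<theta>s i) * B (1 - i) i"
    using i(1) assms(1) by (subst co_X) auto
  moreover have "B (1 - i) i \<noteq> 0"
    using i(1) assms(1) tridiagonal by (auto simp: irreducible_tridiagonal_def)
  ultimately have "X (1 *s v i) \<noteq> 0"
    using i(2) by auto
  then have "X \<noteq> (\<lambda>x. 0)"
    by auto
  with mem show ?thesis
    by auto
qed

section \<open>The three types: Krawtchouk, Hahn, dual q-Krawtchouk\<close>

lemma Krawtchouk_nontrivial:
  assumes "Krawtchouk_array d \<theta> \<theta>s \<phi> \<phi>2" and "d \<ge> 1"
  shows "zero_diagonal_space d A As Es \<noteq> {\<lambda>x. 0}"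
proof -
  obtain s ss r where ss: "ss \<noteq> 0"
    and \<theta>: "\<forall>i\<in>{0..d}. \<theta> i = \<theta> 0 + s * of_nat i"
    and \<theta>s: "\<forall>i\<in>{0..d}. \<theta>s i = \<theta>s 0 + ss * of_nat i"
    and \<phi>: "\<forall>i\<in>{1..d}. \<phi> i = r * of_nat i * (of_nat i - of_nat d - 1)"
    using assms(1) unfolding Krawtchouk_array_def by blast
  \<comment> \<open>\<open>\<theta>s\<close> has constant increment \<open>ss\<close>, so
    \<open>\<epsilon>_split\<close> gives the interior cases; at 0 and \<open>Suc d\<close> the
    right side vanishes, as \<epsilon> does.\<close>
  have \<epsilon>: "ss * \<epsilon> i = - r * of_nat i * (of_nat i - of_nat d - 1)" if i_le: "i \<le> Suc d" for i
  proof -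
    consider "i = 0" | "i = Suc d" | j where "i = Suc j" "i \<in> {1..d}"
      using i_le by (cases "i = 0 \<or> i = Suc d") (auto simp: gr0_conv_Suc)
    then show ?thesis
    proof cases
      case 3
      have "\<theta>s i - \<theta>s (i - 1) = ss"
        using 3 \<theta>s[rule_format, of i] \<theta>s[rule_format, of j] by (simp add: algebra_simps)
      then show ?thesis
        using \<epsilon>_split[OF 3(2)] \<phi>[rule_format, OF 3(2)] by (simp add: mult.commute)
    qed (simp_all add: \<epsilon>_0 \<epsilon>_end)
  qed
  show ?thesis
  proof (rule zero_diagonal_space_nontrivial)
    \<comment> \<open>One factor \<open>ss\<close> clears the denominator of \<epsilon>; the other
      lets \<open>ss * n\<close> be replaced by \<open>\<theta>s i - \<theta>s 0\<close>.\<close>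
    show "ss * ss \<noteq> 0 \<or> (0::'a) \<noteq> 0"
      using ss by simp
    fix i assume i: "i \<le> d"
    define n :: 'a where "n = of_nat i"
    have e: "ss * \<epsilon> i = - r * n * (n - of_nat d - 1)"
      "ss * \<epsilon> (Suc i) = - r * (1 + n) * (1 + n - of_nat d - 1)"
      using \<epsilon>[of i] \<epsilon>[of "Suc i"] i by (simp_all only: n_def of_nat_Suc Suc_le_mono le_SucI)
    have t: "\<theta> i - \<theta> 0 = s * n" "\<theta>s i - \<theta>s 0 = ss * n"
      using i \<theta>[rule_format, of i] \<theta>s[rule_format, of i] by (simp_all add: n_def)
    have "(ss * ss + 0 * (\<theta>s i - \<theta>s 0)) * (\<theta> i + \<epsilon> (Suc i) - \<epsilon> i - \<theta> 0)
        = ss * ss * (\<theta> i - \<theta> 0) + ss * (ss * \<epsilon> (Suc i)) - ss * (ss * \<epsilon> i)"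
      by (simp add: algebra_simps)
    also have "\<dots> = ss * r * of_nat d + (ss * s - 2 * r) * (\<theta>s i - \<theta>s 0)"
      unfolding e t by (simp add: algebra_simps)
    finally show "(ss * ss + 0 * (\<theta>s i - \<theta>s 0)) * (\<theta> i + \<epsilon> (Suc i) - \<epsilon> i - \<theta> 0)
        = ss * r * of_nat d + (ss * s - 2 * r) * (\<theta>s i - \<theta>s 0)" .
  qed (use assms in simp)
qed

text \<open>The increments of \<open>\<theta>s\<close> put the denominators
  \<open>2 * i + ss\<close> and \<open>2 * i + 2 + ss\<close> into the diagonal entry. Their
  product, and the polynomial left after clearing them, are affine in
  \<open>i * (i + 1 + ss)\<close>, hence in \<open>\<theta>s i\<close>.\<close>

lemma Hahn_nontrivial:
  assumes "Hahn_array d \<theta> \<theta>s \<phi> \<phi>2" and "d \<ge> 3"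
  shows "zero_diagonal_space d A As Es \<noteq> {\<lambda>x. 0}"
proof -
  obtain hs s ss r where hs: "hs \<noteq> 0"
    and char: "CHAR('a) = 0 \<or> prime CHAR('a) \<and> CHAR('a) > d"
    and \<theta>: "\<forall>i\<in>{0..d}. \<theta> i = \<theta> 0 + s * of_nat i"
    and \<theta>s: "\<forall>i\<in>{0..d}. \<theta>s i = \<theta>s 0 + hs * of_nat i * (of_nat i + 1 + ss)"
    and \<phi>: "\<forall>i\<in>{1..d}. \<phi> i
      = hs * s * of_nat i * (of_nat i - of_nat d - 1) * (of_nat i + r)"
    using assms(1) unfolding Hahn_array_def by blast
  \<comment> \<open>Kept free of division: \<open>2 i + ss\<close> may vanish for \<open>i = 0\<close> and \<open>i = d + 1\<close>.\<close>
  have \<epsilon>: "\<epsilon> i * (2 * of_nat i + ss)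
      = - s * of_nat i * (of_nat i - of_nat d - 1) * (of_nat i + r)" if i_le: "i \<le> Suc d" for i
  proof -
    consider "i = 0" | "i = Suc d" | j where "i = Suc j" "i \<in> {1..d}"
      using i_le by (cases "i = 0 \<or> i = Suc d") (auto simp: gr0_conv_Suc)
    then show ?thesis
    proof cases
      case 3
      have "\<theta>s i - \<theta>s (i - 1) = hs * (2 * of_nat i + ss)"
        using 3 \<theta>s[rule_format, of i] \<theta>s[rule_format, of j] by (simp add: algebra_simps)
      then have "hs * (\<epsilon> i * (2 * of_nat i + ss))
          = hs * (- s * of_nat i * (of_nat i - of_nat d - 1) * (of_nat i + r))"
        using \<epsilon>_split[OF 3(2)] \<phi>[rule_format, OF 3(2)] by (simp add: mult_ac)
      then show ?thesis
        using hs by (simp only: mult_cancel_left) simp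
    qed (simp_all add: \<epsilon>_0 \<epsilon>_end)
  qed
  \<comment> \<open>The characteristic is 0 or exceeds \<open>d\<close>, which is at least
    3.\<close>
  have "(of_nat 2 :: 'a) \<noteq> 0"
    using char assms(2) unfolding of_nat_eq_0_iff_char_dvd by (auto dest: dvd_imp_le)
  then have four: "(4 :: 'a) \<noteq> 0"
    using mult_eq_0_iff[of "2 :: 'a" 2] by simp
  show ?thesis
  proof (rule zero_diagonal_space_nontrivial)
    \<comment> \<open>These coefficients come from \<open>(2 * n + ss) * (2 * n + 2 + ss) = 4 * n *
      (n + 1 + ss) + ss * (ss + 2)\<close>, multiplied by \<open>hs\<close>.\<close>
    show "hs * ss * (ss + 2) \<noteq> 0 \<or> (4::'a) \<noteq> 0"
      using four by simp
    fix i assume i: "i \<le> d"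
    define n :: 'a where "n = of_nat i"
    have e: "\<epsilon> i * (2 * n + ss) = - s * n * (n - of_nat d - 1) * (n + r)"
      "\<epsilon> (Suc i) * (2 * n + 2 + ss) = - s * (n + 1) * (n - of_nat d) * (n + 1 + r)"
      using \<epsilon>[of i] \<epsilon>[of "Suc i"] i by (simp_all add: n_def algebra_simps)
    have t: "\<theta> i - \<theta> 0 = s * n" "\<theta>s i - \<theta>s 0 = hs * n * (n + 1 + ss)"
      using i \<theta>[rule_format, of i] \<theta>s[rule_format, of i] by (simp_all add: n_def)
    have "(hs * ss * (ss + 2) + 4 * (\<theta>s i - \<theta>s 0)) * (\<theta> i + \<epsilon> (Suc i) - \<epsilon> i - \<theta> 0)
        = hs * (2 * n + ss) * (2 * n + 2 + ss) * ((\<theta> i - \<theta> 0) + \<epsilon> (Suc i) - \<epsilon> i)"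
      unfolding t(2) by (simp add: algebra_simps)
    also have "\<dots> = hs * (2 * n + ss) * (2 * n + 2 + ss) * (\<theta> i - \<theta> 0)
        + hs * (2 * n + ss) * (\<epsilon> (Suc i) * (2 * n + 2 + ss))
        - hs * (2 * n + 2 + ss) * (\<epsilon> i * (2 * n + ss))"
      by (simp add: algebra_simps)
    also have "\<dots> = hs * s * ss * of_nat d * (1 + r)
        + s * (ss + 2 * of_nat d - 2 * r) * (\<theta>s i - \<theta>s 0)"
      unfolding e t by (simp add: algebra_simps)
    finally show "(hs * ss * (ss + 2) + 4 * (\<theta>s i - \<theta>s 0)) * (\<theta> i + \<epsilon> (Suc i) - \<epsilon> i - \<theta> 0)
        = hs * s * ss * of_nat d * (1 + r)
          + s * (ss + 2 * of_nat d - 2 * r) * (\<theta>s i - \<theta>s 0)" .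
  qed (use assms in simp)
qed

text \<open>The terms in the inverse of \<open>q ^ i\<close> cancel between
  \<open>\<theta> i\<close> and the difference of consecutive \<epsilon>. What remains is affine in
  \<open>q ^ i\<close>, so after suitable shifts its product with \<open>\<theta>s i\<close> is
  constant.\<close>

lemma dual_q_Krawtchouk_nontrivial:
  assumes "dual_q_Krawtchouk_array d \<theta> \<theta>s \<phi> \<phi>2" and "d \<ge> 1"
  shows "zero_diagonal_space d A As Es \<noteq> {\<lambda>x. 0}"
proof -
  obtain q h hs s where q: "q \<noteq> 0" and hs: "hs \<noteq> 0"
    and q_power: "\<forall>i\<in>{1..d}. q ^ i \<noteq> 1"
    and \<theta>: "\<forall>i\<in>{0..d}. \<theta> i = \<theta> 0 + h * (1 - q ^ i) * (1 - s * q ^ (i + 1)) * q powi (- int i)"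
    and \<theta>s: "\<forall>i\<in>{0..d}. \<theta>s i = \<theta>s 0 + hs * (1 - q ^ i) * q powi (- int i)"
    and \<phi>: "\<forall>i\<in>{1..d}. \<phi> i = h * hs * q powi (1 - 2 * int i) * (1 - q ^ i)
      * (1 - q powi (int i - int d - 1))"
    using assms(1) unfolding dual_q_Krawtchouk_array_def by blast
  have q1: "1 - q \<noteq> 0"
    using q_power[rule_format, of 1] assms(2) by auto
  define D where "D = inverse (q ^ d)"
  define R where "R i = inverse (q ^ i)" for i
  have R: "q ^ i * R i = 1" "q powi (- int i) = R i" "R (Suc i) * q = R i" for i
    using q by (simp_all add: R_def power_int_minus field_simps)
  have \<theta>s_R: "\<theta>s i - \<theta>s 0 = hs * (R i - 1)" if "i \<le> d" for i
    using that \<theta>s[rule_format, of i] R(1)[of i] R(2)[of i] by (simp add: algebra_simps)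
  \<comment> \<open>The boundary values agree: \<open>1 - q ^ i\<close> vanishes at 0, and
    \<open>q * R i - D\<close> vanishes at \<open>Suc d\<close>.\<close>
  have \<epsilon>: "\<epsilon> i * (1 - q) = - h * (1 - q ^ i) * (q * R i - D)" if i_le: "i \<le> Suc d" for i
  proof -
    consider "i = 0" | "i = Suc d" | j where "i = Suc j" "i \<in> {1..d}"
      using i_le by (cases "i = 0 \<or> i = Suc d") (auto simp: gr0_conv_Suc)
    then show ?thesis
    proof cases
      case 2
      then have "q * R i - D = 0"
        using q by (simp add: R_def D_def)
      then show ?thesis
        using 2 by (simp add: \<epsilon>_end)
    next
      case 3
      have "\<theta>s i - \<theta>s (i - 1) = (\<theta>s i - \<theta>s 0) - (\<theta>s j - \<theta>s 0)"
        using 3 by simp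
      also have "\<dots> = hs * (R i - R j)"
        using 3 by (subst (1 2) \<theta>s_R) (auto simp: algebra_simps)
      finally have "\<theta>s i - \<theta>s (i - 1) = hs * (R i - R j)" .
      then have diff: "\<theta>s i - \<theta>s (i - 1) = hs * R i * (1 - q)"
        using R(3)[of j] 3(1) by (simp add: algebra_simps)
      have "q powi (1 - 2 * int i) = q * R i * R i"
        using q by (simp add: power_int_diff power_int_mult R_def field_simps power2_eq_square
            power_mult[symmetric] mult_2 power_add)
      moreover have "q powi (int i - int d - 1) = q ^ i * D / q"
        using q by (simp add: power_int_diff power_int_add D_def field_simps)
      ultimately have "\<phi> i = h * hs * (q * R i * R i) * (1 - q ^ i) * (1 - q ^ i * D / q)"
        using \<phi>[rule_format, OF 3(2)] by (simp only:)
      also have "\<dots> = hs * R i * (h * (1 - q ^ i) * (q * R i - q ^ i * R i * D))"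
        using q by (simp add: field_simps)
      finally have \<phi>_R: "\<phi> i = hs * R i * (h * (1 - q ^ i) * (q * R i - D))"
        by (simp only: R(1) mult_1_left)
      have "hs * R i * (\<epsilon> i * (1 - q)) = \<epsilon> i * (\<theta>s i - \<theta>s (i - 1))"
        by (simp only: diff mult_ac)
      also have "\<dots> = hs * R i * (- h * (1 - q ^ i) * (q * R i - D))"
        unfolding \<epsilon>_split[OF 3(2)] \<phi>_R by simp
      finally have "hs * R i * (\<epsilon> i * (1 - q)) = hs * R i * (- h * (1 - q ^ i) * (q * R i - D))" .
      moreover have "hs * R i \<noteq> 0"
        using hs q by (simp add: R_def)
      ultimately show ?thesis
        by (simp only: mult_cancel_left) simp
    qed (simp_all add: \<epsilon>_0)
  qed
  show ?thesis
  proof (rule zero_diagonal_space_nontrivial)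
    \<comment> \<open>Here \<open>hs + (\<theta>s i - \<theta>s 0)\<close> is
      \<open>hs * R i\<close>, and subtracting \<open>\<theta> 0 - h * (1 + s * q)\<close> from the
      diagonal entry leaves \<open>h * (s * q + D) * q ^ i\<close>.\<close>
    show "hs \<noteq> 0 \<or> (1::'a) \<noteq> 0"
      by simp
    fix i assume i: "i \<le> d"
    have RQ: "R i * q ^ i = 1"
      using R(1)[of i] by (simp add: mult.commute)
    have e': "\<epsilon> i * (1 - q) = - h * (1 - q ^ i) * (q * R i - D)"
      "\<epsilon> (Suc i) * (1 - q) = - h * (1 - q * q ^ i) * (R i - D)"
      using \<epsilon>[of i] \<epsilon>[of "Suc i"] i R(3)[of i] by (simp_all add: mult.commute[of q])
    have "(1 - q) * (\<epsilon> (Suc i) - \<epsilon> i) = \<epsilon> (Suc i) * (1 - q) - \<epsilon> i * (1 - q)"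
      by (simp add: algebra_simps)
    also have "\<dots> = (1 - q) * (h * q ^ i * D - h * R i)"
      unfolding e' by (simp add: algebra_simps)
    finally have e: "\<epsilon> (Suc i) - \<epsilon> i = h * q ^ i * D - h * R i"
      using q1 by simp
    have t: "\<theta> i - \<theta> 0 = h * (R i - 1 - s * q + s * q * q ^ i)"
      using i \<theta>[rule_format, of i] R(2)[of i] RQ by (simp add: algebra_simps)
    have "(hs + 1 * (\<theta>s i - \<theta>s 0)) * (\<theta> i + \<epsilon> (Suc i) - \<epsilon> i - (\<theta> 0 - h * (1 + s * q)))
        = hs * R i * ((\<theta> i - \<theta> 0) + (\<epsilon> (Suc i) - \<epsilon> i) + h * (1 + s * q))"
      by (simp add: \<theta>s_R[OF i] algebra_simps)
    also have "\<dots> = hs * h * (s * q + D) * (R i * q ^ i)"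
      unfolding e t by (simp add: algebra_simps)
    finally show "(hs + 1 * (\<theta>s i - \<theta>s 0))
        * (\<theta> i + \<epsilon> (Suc i) - \<epsilon> i - (\<theta> 0 - h * (1 + s * q)))
        = hs * h * (s * q + D) + 0 * (\<theta>s i - \<theta>s 0)"
      using RQ by simp
  qed (use assms in simp)
qed

end

section \<open>From a Leonard system to a pair of eigenbases\<close>

context leonard_context
begin

text \<open>The standard orderings and the split sequence come with eigenvalue sequences of their
  own. The idempotents determine the eigenvalues, so up to index \<open>d\<close> all of them agree
  with the parameter array.\<close>

lemma eigenbases_exist:
  assumes "leonard_system d A E As Es" and "parameter_array d A E As Es \<theta> \<theta>s \<phi> \<phi>2"
  obtains v w where "leonard_eigenbases scale d A As Es \<theta> \<theta>s \<phi> v w"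
proof -
  have p: "eigenvalue_sequence d A E \<theta>" "eigenvalue_sequence d As Es \<theta>s"
      "first_split_sequence d A E As Es \<phi>"
    using assms(2) by (auto simp: parameter_array_def)
  have lin: "Vector_Spaces.linear scale scale A" "Vector_Spaces.linear scale scale As"
    using assms(1) by (auto simp: leonard_system_def leonard_pair_def)
  obtain \<theta>' w where \<theta>': "eigenvalue_sequence d A E \<theta>'" "\<And>i. i \<le> d \<Longrightarrow> w i \<in> eigenspace A (\<theta>' i)"
    and w: "ordered_basis d w"
    using assms(1)
    unfolding leonard_system_def standard_ordering_def tridiagonal_diagonal_basis_def by blast
  have eigen_w: "w i \<in> eigenspace A (\<theta> i)" if "i \<le> d" for i
    using \<theta>'(2)[OF that] eigenvalue_sequence_unique[OF p(1) \<theta>'(1) that] by simp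
  obtain \<theta>s' v where \<theta>s': "eigenvalue_sequence d As Es \<theta>s'" "inj_on \<theta>s' {..d}"
      "\<And>i. i \<le> d \<Longrightarrow> v i \<in> eigenspace As (\<theta>s' i)"
    and v: "ordered_basis d v" "irreducible_tridiagonal d (matrix_wrt d v A)"
    using assms(1)
    unfolding leonard_system_def standard_ordering_def tridiagonal_diagonal_basis_def bij_betw_def
    by blast
  have eq: "\<theta>s i = \<theta>s' i" if "i \<le> d" for i
    using eigenvalue_sequence_unique[OF p(2) \<theta>s'(1) that] .
  have eigen_v: "v i \<in> eigenspace As (\<theta>s i)" if "i \<le> d" for i
    using \<theta>s'(3) eq that by auto
  have inj: "inj_on \<theta>s {..d}"
    using \<theta>s'(2) eq by (auto simp: inj_on_def)
  have "range (Es 0) = eigenspace As (\<theta>s 0)"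
    using p(2) by (auto simp: eigenvalue_sequence_def primitive_idempotent_def
        projection_onto_along_def)
  \<comment> \<open>This makes \<open>v 0\<close> an admissible starting vector in the definition of
    the first split sequence.\<close>
  then have "v 0 \<in> range (Es 0)"
    using eigen_v[of 0] by simp
  moreover have "v 0 \<noteq> 0"
    using coord_basis[OF v(1), of 0 0] by auto
  moreover obtain \<theta>1 \<theta>s1
    where s: "eigenvalue_sequence d A E \<theta>1" "eigenvalue_sequence d As Es \<theta>s1"
      "\<And>u i. u \<in> range (Es 0) \<Longrightarrow> u \<noteq> 0 \<Longrightarrow> i \<in> {1..d} \<Longrightarrow> As (split_vector A \<theta>1 u i) =
        \<theta>s1 i *s split_vector A \<theta>1 u i + \<phi> i *s split_vector A \<theta>1 u (i - 1)"
    using p(3) unfolding first_split_sequence_def by blast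
  ultimately have "As (split_vector A \<theta>1 (v 0) i) =
       \<theta>s1 i *s split_vector A \<theta>1 (v 0) i + \<phi> i *s split_vector A \<theta>1 (v 0) (i - 1)"
    if "i \<in> {1..d}" for i
    using that by blast
  moreover have "split_vector A \<theta>1 (v 0) i = split_vector A \<theta> (v 0) i" if "i \<le> d" for i
    using that eigenvalue_sequence_unique[OF p(1) s(1)] by (intro split_vector_cong) simp
  moreover have "\<theta>s1 i = \<theta>s i" if "i \<le> d" for i
    using eigenvalue_sequence_unique[OF p(2) s(2) that] by simp
  ultimately have split: "As (split_vector A \<theta> (v 0) i) =
       \<theta>s i *s split_vector A \<theta> (v 0) i + \<phi> i *s split_vector A \<theta> (v 0) (i - 1)"
    if "i \<in> {1..d}" for i
    using that by auto
  then have "leonard_eigenbases scale d A As Es \<theta> \<theta>s \<phi> v w"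
    using lin v w eigen_v eigen_w inj p(2) split
    by (intro leonard_eigenbases.intro leonard_eigenbases_axioms.intro leonard_context_axioms)
      (simp_all add: eigenspace_def)
  then show ?thesis
    by (rule that)
qed

end

theorem theorem9p1:
  fixes scale :: "'a::alg_closed_field \<Rightarrow> 'b::ab_group_add \<Rightarrow> 'b"
    and d :: nat
    and A As :: "'b \<Rightarrow> 'b"
    and E Es :: "nat \<Rightarrow> 'b \<Rightarrow> 'b"
  assumes "vector_space scale"
    and "d \<ge> 3"
    and "vector_space.dim scale (UNIV :: 'b set) = d + 1"
    and "leonard_context.leonard_system scale d A E As Es"
    and "leonard_context.dual_q_Krawtchouk_type scale d A E As Es \<or>
         leonard_context.Hahn_type scale d A E As Es \<or>
         leonard_context.Krawtchouk_type scale d A E As Es"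
  shows "leonard_context.zero_diagonal_space scale d A As Es \<noteq> {\<lambda>x. 0}"
proof -
  interpret leonard_context scale
    using assms(1) by (simp add: leonard_context_def)
  obtain \<theta> \<theta>s \<phi> \<phi>2 where p: "parameter_array d A E As Es \<theta> \<theta>s \<phi> \<phi>2"
    and type: "dual_q_Krawtchouk_array d \<theta> \<theta>s \<phi> \<phi>2 \<or> Hahn_array d \<theta> \<theta>s \<phi> \<phi>2
      \<or> Krawtchouk_array d \<theta> \<theta>s \<phi> \<phi>2"
    using assms(5)
    unfolding dual_q_Krawtchouk_type_def Hahn_type_def Krawtchouk_type_def by blast
  obtain v w where "leonard_eigenbases scale d A As Es \<theta> \<theta>s \<phi> v w"
    using eigenbases_exist[OF assms(4) p] .
  then interpret leonard_eigenbases scale d A As Es \<theta> \<theta>s \<phi> v w .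
  show ?thesis
    using type assms(2) dual_q_Krawtchouk_nontrivial Hahn_nontrivial Krawtchouk_nontrivial
    by auto
qed

end
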